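(* Let $M=\{3,6,9,12,15,18,21,24,27\}$. For each nonempty subset $T\subseteq M$ consider the two triples of circulant graphs of order $54$ $$\mathcal{A}_T=\bigl(C_{54}(\{1,17,19\}\cup T),\; C_{54}(\{7,11,25\}\cup T),\; C_{54}(\{5,13,23\}\cup T)\bigr),$$ $$\mathcal{B}_T=\bigl(C_{54}(\{2,16,20\}\cup T),\; C_{54}(\{4,14,22\}\cup T),\; C_{54}(\{8,10,26\}\cup T)\bigr).$$ This gives $2\cdot 511=1022$ triples. Then: (i) for every nonempty $T\subseteq M$, the three graphs in $\mathcal{A}_T$ are isomorphic to one another, and the three graphs in $\mathcal{B}_T$ are isomorphic to one another; (ii) among these $1022$ triples, exactly $960$ are triples of Type-2 isomorphic circulant graphs with respect to $m=3$ (that is, the three graphs of the triple are pairwise Type-2 isomorphic with respect to $m=3$).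
   Context: For $n\in\mathbb{N}$ and $R\subseteq\{1,\dots,\lfloor n/2\rfloor\}$, the circulant graph $C_n(R)$ has vertices $v_0,\dots,v_{n-1}$ with $v_x$ adjacent to $v_{x+s}$ and $v_{x-s}$ (subscripts modulo $n$) for all $x\in\mathbb{Z}_n$ and $s\in R$. The elements of $R$ are called jump sizes. Reflexive reduction modulo $n$: reduce each term of a sequence modulo $n$, then replace every resulting term $r'>n/2$ by $n-r'$. For $y$ with $\gcd(n,y)=1$, $yR$ denotes the set of reflexive reductions modulo $n$ of $\{yr: r\in R\}$. $\varphi_n$ denotes the set of $y$ with $1\le y\le n$ and $\gcd(n,y)=1$. The map $\theta_{n,m,t}$: let $|R|\ge 3$, let $r\in R$, and let $m>1$ be such that $m$ divides $\gcd(n,r)$ and $m^3$ divides $n$. Let $V(K_n)=\{u_0,\dots,u_{n-1}\}$. For $0\le t\le \frac{n}{m}-1$ define the injective map $\theta_{n,m,t}:V(C_n(R))\to V(K_n)$ by $\theta_{n,m,t}(v_x)=u_{x+jtm}$ (subscripts modulo $n$), where $x=qm+j$ with $0\le j\le m-1$ and $0\le q\le \frac nm-1$; edges are mapped by $\theta_{n,m,t}((v_x,v_{x+s}))=(\theta_{n,m,t}(v_x),\theta_{n,m,t}(v_{x+s}))$. Thus $\theta_{n,m,t}(C_n(R))$ is a graph on $\{u_0,\dots,u_{n-1}\}$, and "$\theta_{n,m,t}(C_n(R))=C_n(S)$" means that it equals the circulant graph with jump set $S$ on these vertices in their natural labelling. Type-2 isomorphism: in this setting, if for some $t$ we have $\theta_{n,m,t}(C_n(R))=C_n(S)$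 for some $S$, and $S\ne yR$ for all $y\in\varphi_n$ (under reflexive reduction modulo $n$), then $C_n(R)$ and $C_n(S)$ are called isomorphic circulant graphs of Type-2 (Type-2 isomorphic) with respect to $m$. By convention, when $C_n(R)$ and $C_n(S)$ are Type-2 isomorphic with respect to $m$, one also says that $C_{kn}(kR)$ and $C_{kn}(kS)$ are Type-2 isomorphic with respect to $m$, for $k\in\mathbb{N}$. *)

theory Defs
  imports "HOL-Number_Theory.Totient"
begin

text \<open>A simple graph is a vertex set together with a set of edges, each edge being the
  two-element set of its endpoints.\<close>

type_synonym 'a graph = "'a set \<times> 'a set set"

definition image_graph :: "('a \<Rightarrow> 'b) \<Rightarrow> 'a graph \<Rightarrow> 'b graph" where
  "image_graph f G = (f ` fst G, (\<lambda>e. f ` e) ` snd G)"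

definition graph_isomorphic :: "'a graph \<Rightarrow> 'b graph \<Rightarrow> bool" where
  "graph_isomorphic G H \<longleftrightarrow>
     (\<exists>f. bij_betw f (fst G) (fst H) \<and>
          (\<forall>u\<in>fst G. \<forall>v\<in>fst G. {u, v} \<in> snd G \<longleftrightarrow> {f u, f v} \<in> snd H))"

text \<open>The vertices $v_x$ and $u_x$ are both represented by the number $x$. The neighbour
  $v_{x-s}$ of $v_x$ is accounted for by the edge starting at $x - s$. The definition is meant
  for \<open>R \<subseteq> {1..n div 2}\<close>.\<close>

definition circulant :: "nat \<Rightarrow> nat set \<Rightarrow> nat graph" where
  "circulant n R = ({0..<n}, {{x, (x + s) mod n} | x s. x < n \<and> s \<in> R})"

definition reflexive_reduction :: "nat \<Rightarrow> nat \<Rightarrow> nat" where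
  "reflexive_reduction n a = (if 2 * (a mod n) > n then n - a mod n else a mod n)"

definition mult_jumps :: "nat \<Rightarrow> nat \<Rightarrow> nat set \<Rightarrow> nat set" where
  "mult_jumps n y R = (\<lambda>r. reflexive_reduction n (y * r)) ` R"

text \<open>Here \<open>x mod m\<close> is the $j$ in the decomposition $x = qm + j$.\<close>

definition theta :: "nat \<Rightarrow> nat \<Rightarrow> nat \<Rightarrow> nat \<Rightarrow> nat" where
  "theta n m t x = (x + (x mod m) * t * m) mod n"

text \<open>The set \<open>totatives n\<close> is $\varphi_n$. The rule \<open>scale\<close> is the convention extending the
  notion from $C_n(R), C_n(S)$ to $C_{kn}(kR), C_{kn}(kS)$; no reduction is needed there, as
  $kr \le kn/2$.\<close>

inductive type2_jumps :: "nat \<Rightarrow> nat \<Rightarrow> nat set \<Rightarrow> nat set \<Rightarrow> bool" where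
  base: "\<lbrakk>R \<subseteq> {1..n div 2}; S \<subseteq> {1..n div 2}; card R \<ge> 3;
      m > 1; r \<in> R; m dvd gcd n r; m ^ 3 dvd n;
      t \<le> n div m - 1;
      image_graph (theta n m t) (circulant n R) = circulant n S;
      \<forall>y \<in> totatives n. S \<noteq> mult_jumps n y R\<rbrakk>
    \<Longrightarrow> type2_jumps n m R S"
| scale: "\<lbrakk>type2_jumps n m R S; k \<ge> 1\<rbrakk>
    \<Longrightarrow> type2_jumps (k * n) m ((\<lambda>r. k * r) ` R) ((\<lambda>s. k * s) ` S)"

definition type2_isomorphic :: "nat \<Rightarrow> nat graph \<Rightarrow> nat graph \<Rightarrow> bool" where
  "type2_isomorphic m G H \<longleftrightarrow>
     (\<exists>n R S. G = circulant n R \<and> H = circulant n S \<and> type2_jumps n m R S)"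

fun pairwise_triple :: "('a \<Rightarrow> 'a \<Rightarrow> bool) \<Rightarrow> 'a \<times> 'a \<times> 'a \<Rightarrow> bool" where
  "pairwise_triple P (a, b, c) \<longleftrightarrow> P a b \<and> P b a \<and> P a c \<and> P c a \<and> P b c \<and> P c b"

definition M54 :: "nat set" where
  "M54 = {3, 6, 9, 12, 15, 18, 21, 24, 27}"

definition tripleA :: "nat set \<Rightarrow> nat graph \<times> nat graph \<times> nat graph" where
  "tripleA T = (circulant 54 ({1, 17, 19} \<union> T),
                circulant 54 ({7, 11, 25} \<union> T),
                circulant 54 ({5, 13, 23} \<union> T))"

definition tripleB :: "nat set \<Rightarrow> nat graph \<times> nat graph \<times> nat graph" where
  "tripleB T = (circulant 54 ({2, 16, 20} \<union> T),
                circulant 54 ({4, 14, 22} \<union> T),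
                circulant 54 ({8, 10, 26} \<union> T))"

definition triples54 :: "(nat graph \<times> nat graph \<times> nat graph) set" where
  "triples54 = {tripleA T | T. T \<subseteq> M54 \<and> T \<noteq> {}} \<union> {tripleB T | T. T \<subseteq> M54 \<and> T \<noteq> {}}"

end

theory Submission
  imports Defs
begin

text \<open>
  A circulant graph on \<open>n\<close> vertices is governed by the set of differences of adjacent vertices, a
  symmetric set of integers modulo \<open>n\<close> (\<open>edge_iff_difference\<close>). For \<open>R \<subseteq> {1..n div 2}\<close> it determines
  \<open>R\<close>, and multiplying \<open>R\<close> by a unit multiplies the differences by that unit
  (\<open>mult_jumps_eq_iff\<close>).

  In each of the six jump sets \<open>R\<close> of the two families, the differences prime to 3 form a union
  \<open>\<plusminus>a + 18\<int>\<close>, where \<open>a\<close> runs through 1, 7, 13 in the first family and through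
  2, 14, 26 in the second; the differences divisible by 3 come from \<open>T\<close>. For \<open>t = 2\<close> and \<open>t = 4\<close>
  the map \<open>theta 54 3 t\<close> keeps differences divisible by 3 and multiplies the others by \<open>1 + 3t\<close>,
  that is by 7 or 13, up to multiples of 18. Since 7 has order 3 modulo 18 and 13 is its inverse, these maps
  permute each triple cyclically in both directions (\<open>theta_coset_jumps\<close>), which gives the
  isomorphisms.

  A unit \<open>y\<close> carrying one member of a triple to another must act on the part prime to 3 as
  \<open>\<plusminus>7\<close> or \<open>\<plusminus>13\<close> modulo 18, and then it acts on the multiples of 3, which only see \<open>y\<close> modulo
  18, in the same way. So it exists exactly when \<open>7T = T\<close>, and the triple is of Type 2
  exactly when \<open>7T \<noteq> T\<close> (\<open>type2_coset_jumps_iff\<close>). Passing to a multiple \<open>kn\<close> of the order does not create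
  further pairs, because a unit relating \<open>R\<close> and \<open>S\<close> modulo \<open>kn\<close> relates them already modulo
  \<open>n\<close> (\<open>type2_jumps_not_mult\<close>).

  Multiplication by 7 has the orbits \<open>{3, 15, 21}\<close>, \<open>{6, 12, 24}\<close>, \<open>{9}\<close>, \<open>{18}\<close>, \<open>{27}\<close> on
  the multiples of 3, so 32 of the 512 sets \<open>T\<close> are stable. The empty set is one of them, and
  \<open>2 (512 - 32) = 960\<close> triples remain.
\<close>

section \<open>Circulant graphs and their differences\<close>

text \<open>Integers rather than residues in \<open>{0..<n}\<close>, so that differences can be negated, multiplied and
  reduced modulo divisors of \<open>n\<close> without normalising.\<close>

definition differences :: "nat \<Rightarrow> nat set \<Rightarrow> int set" where
  "differences n R = {d. \<exists>r\<in>R. [d = int r] (mod int n) \<or> [d = - int r] (mod int n)}"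

lemma differences_Un: "differences n (R \<union> S) = differences n R \<union> differences n S"
  by (auto simp: differences_def)

lemma differences_cong:
  assumes "[d = e] (mod int n)"
  shows "d \<in> differences n R \<longleftrightarrow> e \<in> differences n R"
  using assms unfolding differences_def by (auto intro: cong_trans dest: cong_sym)

lemma differences_uminus: "- d \<in> differences n R \<longleftrightarrow> d \<in> differences n R"
proof -
  have "[- d = x] (mod int n) \<longleftrightarrow> [d = - x] (mod int n)" for x
    by (metis cong_minus_minus_iff minus_minus)
  then show ?thesis
    unfolding differences_def by auto
qed

text \<open>Two numbers in \<open>{1..n div 2}\<close> that agree up to sign modulo \<open>n\<close> are equal.\<close>

lemma jump_iff_difference:
  assumes "R \<subseteq> {1..n div 2}" "r \<in> {1..n div 2}"
  shows "int r \<in> differences n R \<longleftrightarrow> r \<in> R"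
proof
  assume "int r \<in> differences n R"
  then obtain s where s: "s \<in> R"
    and d: "int n dvd int r - int s \<or> int n dvd int r + int s"
    by (auto simp: differences_def cong_iff_dvd_diff)
  have sb: "s \<in> {1..n div 2}" using s assms by auto
  from d have "r = s"
  proof
    assume "int n dvd int r - int s"
    moreover have "\<bar>int r - int s\<bar> < int n" using sb assms(2) by auto
    ultimately show ?thesis using zdvd_not_zless dvd_imp_le_int
      by (metis abs_of_nat eq_iff_diff_eq_0 int_int_eq not_le)
  next
    assume "int n dvd int r + int s"
    then have "int n \<le> int r + int s" using sb by (intro zdvd_imp_le) auto
    then show ?thesis using sb assms(2) by auto
  qed
  then show "r \<in> R" using s by simp
next
  assume "r \<in> R"
  then show "int r \<in> differences n R"
    unfolding differences_def using cong_refl by blast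
qed

lemma differences_inject:
  assumes "R \<subseteq> {1..n div 2}" "S \<subseteq> {1..n div 2}" "differences n R = differences n S"
  shows "R = S"
  using assms jump_iff_difference by blast

lemma edge_iff_difference:
  assumes "u < n" "v < n"
  shows "{u, v} \<in> snd (circulant n R) \<longleftrightarrow> int v - int u \<in> differences n R"
proof -
  have step: "q = (p + s) mod n \<longleftrightarrow> [int q - int p = int s] (mod int n)"
    if "q < n" for p q s
  proof -
    have "q = (p + s) mod n \<longleftrightarrow> [int q = int p + int s] (mod int n)"
      using that by (metis cong_def cong_int_iff mod_less of_nat_add)
    then show ?thesis
      by (simp add: cong_iff_dvd_diff algebra_simps)
  qed
  have "{u, v} \<in> snd (circulant n R) \<longleftrightarrow> (\<exists>s\<in>R. v = (u + s) mod n \<or> u = (v + s) mod n)"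
    using assms by (auto simp: circulant_def doubleton_eq_iff)
  also have "\<dots> \<longleftrightarrow> (\<exists>s\<in>R. [int v - int u = int s] (mod int n) \<or>
                          [int u - int v = int s] (mod int n))"
    using step assms by blast
  also have "\<dots> \<longleftrightarrow> int v - int u \<in> differences n R"
    unfolding differences_def using cong_minus_minus_iff[of "int v - int u"]
    by (simp; metis cong_minus_minus_iff minus_diff_eq minus_minus)
  finally show ?thesis .
qed

lemma edge_ends:
  assumes "e \<in> snd (circulant n R)"
  obtains u v where "u < n" "v < n" "e = {u, v}"
proof -
  from assms obtain x s where "x < n" "e = {x, (x + s) mod n}"
    by (auto simp: circulant_def)
  then show ?thesis by (intro that[of x "(x + s) mod n"]) auto
qed

lemma circulant_inject:
  assumes "R \<subseteq> {1..n div 2}" "S \<subseteq> {1..n div 2}" "circulant n R = circulant n S"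
  shows "R = S"
proof -
  have "r \<in> R \<longleftrightarrow> r \<in> S" if r: "r \<in> {1..n div 2}" for r
  proof -
    have "0 < n" "r < n" using r by auto
    then have "int r \<in> differences n R \<longleftrightarrow> int r \<in> differences n S"
      using edge_iff_difference[of 0 n r R] edge_iff_difference[of 0 n r S] assms(3) by simp
    then show ?thesis
      using jump_iff_difference[OF assms(1) r] jump_iff_difference[OF assms(2) r] by simp
  qed
  with assms(1,2) show ?thesis by blast
qed

lemma circulant_image_bij:
  assumes bij: "bij_betw f {0..<n} {0..<n}"
    and adj: "\<And>u v. u < n \<Longrightarrow> v < n \<Longrightarrow>
      {u, v} \<in> snd (circulant n R) \<longleftrightarrow> {f u, f v} \<in> snd (circulant n S)"
  shows "image_graph f (circulant n R) = circulant n S"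
    and "graph_isomorphic (circulant n R) (circulant n S)"
proof -
  have V: "fst (circulant n Q) = {0..<n}" for Q by (simp add: circulant_def)
  show "graph_isomorphic (circulant n R) (circulant n S)"
    unfolding graph_isomorphic_def V using bij adj by auto
  have "(\<lambda>e. f ` e) ` snd (circulant n R) = snd (circulant n S)"
  proof (intro equalityI subsetI)
    fix e assume "e \<in> (\<lambda>e. f ` e) ` snd (circulant n R)"
    then obtain e' where e': "e' \<in> snd (circulant n R)" "e = f ` e'" by blast
    obtain u v where "u < n" "v < n" "e' = {u, v}" using edge_ends[OF e'(1)] .
    then show "e \<in> snd (circulant n S)" using e' adj by auto
  next
    fix e assume e: "e \<in> snd (circulant n S)"
    obtain u v where uv: "u < n" "v < n" "e = {u, v}" using edge_ends[OF e] .
    have im: "f ` {0..<n} = {0..<n}" using bij by (simp add: bij_betw_def)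
    obtain u' v' where uv': "u' < n" "v' < n" "u = f u'" "v = f v'"
      using uv im by (metis (no_types, lifting) atLeastLessThan_iff imageE le0)
    then have "{u', v'} \<in> snd (circulant n R)" using adj uv e by simp
    then show "e \<in> (\<lambda>e. f ` e) ` snd (circulant n R)"
      using uv uv' by (intro image_eqI[of _ _ "{u', v'}"]) auto
  qed
  then show "image_graph f (circulant n R) = circulant n S"
    using bij unfolding image_graph_def V
    by (simp add: bij_betw_def prod_eq_iff V)
qed

section \<open>Multiplying jump sets by units\<close>

lemma reflexive_reduction_cong:
  assumes "n > 0"
  shows "[int (reflexive_reduction n a) = int a] (mod int n) \<or>
         [int (reflexive_reduction n a) = - int a] (mod int n)"
proof (cases "2 * (a mod n) > n")
  case True
  have "a mod n < n" using assms by simp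
  then have "int (reflexive_reduction n a) = int n - int a mod int n"
    using True by (simp add: reflexive_reduction_def of_nat_diff zmod_int)
  moreover have "[int n - int a mod int n = - int a] (mod int n)"
    by (simp add: cong_def mod_simps)
  ultimately show ?thesis by simp
next
  case False
  then show ?thesis
    by (simp add: reflexive_reduction_def cong_def zmod_int)
qed

lemma reflexive_reduction_le: "n > 0 \<Longrightarrow> reflexive_reduction n a \<le> n div 2"
  by (auto simp: reflexive_reduction_def)

lemma reflexive_reduction_pos: "\<not> n dvd a \<Longrightarrow> n > 0 \<Longrightarrow> reflexive_reduction n a \<ge> 1"
  using mod_less_divisor[of n a]
  by (auto simp: reflexive_reduction_def dvd_eq_mod_eq_0 simp del: mod_less_divisor)

lemma differences_reflexive_reduction:
  assumes "n > 0"
  shows "differences n (reflexive_reduction n ` A) = differences n A"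
proof -
  have "([d = int (reflexive_reduction n a)] (mod int n) \<or>
         [d = - int (reflexive_reduction n a)] (mod int n)) \<longleftrightarrow>
        ([d = int a] (mod int n) \<or> [d = - int a] (mod int n))" for d a
    using reflexive_reduction_cong[OF assms, of a]
    by (metis cong_minus_minus_iff cong_sym cong_trans minus_minus)
  then show ?thesis by (simp add: differences_def)
qed

lemma mult_jumps_alt: "mult_jumps n y R = reflexive_reduction n ` ((*) y ` R)"
  by (simp add: mult_jumps_def image_image)

lemma mult_jumps_subset:
  assumes "coprime y n" "R \<subseteq> {1..n div 2}"
  shows "mult_jumps n y R \<subseteq> {1..n div 2}"
proof
  fix s assume "s \<in> mult_jumps n y R"
  then obtain r where r: "r \<in> R" "s = reflexive_reduction n (y * r)"
    by (auto simp: mult_jumps_def)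
  have "r \<in> {1..n div 2}" using r assms(2) by blast
  then have "r \<ge> 1" "r < n" by auto
  then have "\<not> n dvd r" by (auto dest: dvd_imp_le)
  then have "\<not> n dvd y * r"
    using assms(1) by (simp add: coprime_commute coprime_dvd_mult_right_iff)
  moreover have "n > 0" using \<open>r < n\<close> by simp
  ultimately show "s \<in> {1..n div 2}"
    using r reflexive_reduction_le reflexive_reduction_pos by auto
qed

text \<open>This turns the existence of a reflexively reduced multiple into a statement about all
  integers \<open>d\<close>, which can be examined separately for multiples of 3 and for the others.\<close>

lemma mult_jumps_eq_iff:
  assumes n: "n > 0" and y: "coprime y n"
    and R: "R \<subseteq> {1..n div 2}" and S: "S \<subseteq> {1..n div 2}"
  shows "S = mult_jumps n y R \<longleftrightarrow>
    (\<forall>d. d \<in> differences n R \<longleftrightarrow> int y * d \<in> differences n S)"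
proof -
  have y': "coprime (int y) (int n)" using y by simp
  have diff: "int y * d \<in> differences n (mult_jumps n y R) \<longleftrightarrow> d \<in> differences n R" for d
  proof -
    have "[int y * d = int y * x] (mod int n) \<longleftrightarrow> [d = x] (mod int n)" for x
      using y' by (rule cong_mult_lcancel)
    from this[of "int _"] this[of "- int _"] show ?thesis
      unfolding mult_jumps_alt differences_reflexive_reduction[OF n]
      by (simp add: differences_def)
  qed
  show ?thesis
  proof
    assume "S = mult_jumps n y R"
    then show "\<forall>d. d \<in> differences n R \<longleftrightarrow> int y * d \<in> differences n S"
      using diff by simp
  next
    assume *: "\<forall>d. d \<in> differences n R \<longleftrightarrow> int y * d \<in> differences n S"
    have "d \<in> differences n S \<longleftrightarrow> d \<in> differences n (mult_jumps n y R)" for d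
    proof -
      obtain z where z: "[int y * z = 1] (mod int n)"
        using y' cong_solve_coprime_int by blast
      have "[int y * (z * d) = d] (mod int n)"
        using cong_mult[OF z cong_refl[of d]] by (simp add: mult.assoc)
      then show ?thesis
        using * diff differences_cong by blast
    qed
    then show "S = mult_jumps n y R"
      using differences_inject[OF S mult_jumps_subset[OF y R]] by blast
  qed
qed

section \<open>The shearing map theta\<close>

text \<open>The residues of \<open>x\<close> and \<open>y\<close> modulo \<open>m\<close> differ by the residue of \<open>y - x\<close> or, if the subtraction
  wraps around, by that residue minus \<open>m\<close>. Only differences that are no multiple of \<open>m\<close> can wrap.\<close>

lemma theta_difference:
  fixes x y n m t :: nat and d :: int
  assumes "m dvd n" "m > 0" "n > 0"
  defines "d \<equiv> int y - int x"
  shows "[int (theta n m t y) - int (theta n m t x) = d + m * t * (d mod m)] (mod int n) \<or>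
    \<not> int m dvd d \<and>
    [int (theta n m t y) - int (theta n m t x) = d + m * t * (d mod m - m)] (mod int n)"
proof -
  define e where "e = int y mod m - int x mod m"
  have th: "[int (theta n m t z) = int z + m * t * (int z mod m)] (mod int n)" for z
    by (simp add: theta_def cong_def zmod_int algebra_simps)
  have main: "[int (theta n m t y) - int (theta n m t x) = d + m * t * e] (mod int n)"
    using cong_diff[OF th[of y] th[of x]] by (simp add: d_def e_def algebra_simps)
  have b: "0 \<le> int y mod m" "int y mod m < m" "0 \<le> int x mod m" "int x mod m < m"
    using assms by auto
  have em: "e mod m = d mod m" by (simp add: e_def d_def mod_simps)
  show ?thesis
  proof (cases "e \<ge> 0")
    case True
    moreover have "e < m" using b unfolding e_def by linarith
    ultimately have "e mod m = e" by (rule mod_pos_pos_trivial)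
    then show ?thesis using main em by simp
  next
    case False
    have "0 \<le> e + m" "e + m < m" using False b unfolding e_def by linarith+
    then have "(e + m) mod m = e + m" by (rule mod_pos_pos_trivial)
    then have dm: "d mod m = e + m" using em by simp
    moreover have "e + m \<noteq> 0" using b unfolding e_def by linarith
    ultimately have "\<not> int m dvd d" by (simp add: dvd_eq_mod_eq_0)
    moreover have "d mod m - m = e" using dm by simp
    ultimately show ?thesis using main by simp
  qed
qed

text \<open>The map preserves residues modulo \<open>m\<close>, and on each residue class it is a translation.\<close>

lemma bij_betw_theta:
  assumes "m dvd n" "n > 0"
  shows "bij_betw (theta n m t) {0..<n} {0..<n}"
proof -
  have "inj_on (theta n m t) {0..<n}"
  proof (rule inj_onI)
    fix x y assume xy: "x \<in> {0..<n}" "y \<in> {0..<n}" "theta n m t x = theta n m t y"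
    have "theta n m t z mod m = z mod m" for z
      using assms by (simp add: theta_def mod_mod_cancel)
    then have "x mod m = y mod m" using xy by metis
    with xy(3) have "[x = y] (mod n)"
      by (simp add: theta_def flip: cong_def)
        (simp add: cong_add_rcancel_nat)
    then show "x = y" using xy by (simp add: cong_def)
  qed
  moreover have "theta n m t ` {0..<n} \<subseteq> {0..<n}" using assms by (auto simp: theta_def)
  ultimately show ?thesis
    by (simp add: bij_betw_def endo_inj_surj)
qed

text \<open>Both values that \<open>theta_difference\<close> allows have to be compatible with the jump sets. The
  two hypotheses together say that, away from the multiples of \<open>m\<close>, the differences of \<open>S\<close> are
  invariant under translation by \<open>m\<^sup>2t\<close>.\<close>

lemma theta_circulant:
  assumes mn: "m dvd n" "m > 0" "n > 0"
    and up: "\<And>d. d \<in> differences n R \<longleftrightarrow> d + m * t * (d mod m) \<in> differences n S"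
    and wrap: "\<And>d. \<not> int m dvd d \<Longrightarrow>
      d \<in> differences n R \<longleftrightarrow> d + m * t * (d mod m - m) \<in> differences n S"
  shows "image_graph (theta n m t) (circulant n R) = circulant n S"
    and "graph_isomorphic (circulant n R) (circulant n S)"
proof -
  have adj: "{u, v} \<in> snd (circulant n R) \<longleftrightarrow>
      {theta n m t u, theta n m t v} \<in> snd (circulant n S)" if "u < n" "v < n" for u v
  proof -
    have "theta n m t u < n" "theta n m t v < n" using mn by (auto simp: theta_def)
    with that show ?thesis
      using theta_difference[OF mn, of t v u] up wrap
      by (auto simp: edge_iff_difference differences_cong)
  qed
  show "image_graph (theta n m t) (circulant n R) = circulant n S"
    and "graph_isomorphic (circulant n R) (circulant n S)"
    using circulant_image_bij[OF bij_betw_theta[OF mn(1,3)] adj] by auto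
qed

section \<open>Type-2 isomorphism excludes multiplication by a unit\<close>

lemma type2_jumps_subset:
  assumes "type2_jumps n m R S"
  shows "R \<subseteq> {1..n div 2} \<and> S \<subseteq> {1..n div 2}"
  using assms
proof induction
  case (scale n m R S k)
  have "k * r \<in> {1..k * n div 2}" if "r \<in> {1..n div 2}" for r
  proof -
    have "2 * r \<le> n" using that by auto
    then have "k * (2 * r) \<le> k * n" by (rule mult_le_mono2)
    then have "k * r \<le> k * n div 2"
      by (simp add: less_eq_div_iff_mult_less_eq mult.commute mult.left_commute)
    then show ?thesis using that scale.hyps by auto
  qed
  then show ?case using scale.IH by blast
qed auto

lemma reflexive_reduction_scale:
  assumes "k \<ge> 1"
  shows "reflexive_reduction (k * n) (k * a) = k * reflexive_reduction n a"
proof -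
  have "2 * (k * (a mod n)) > k * n \<longleftrightarrow> 2 * (a mod n) > n"
    using assms by (metis mult.left_commute mult_less_cancel1 less_le_trans zero_less_one)
  then show ?thesis
    by (simp add: reflexive_reduction_def mult_mod_right[symmetric] diff_mult_distrib2)
qed

text \<open>The induction makes the exclusion of unit multiples, which only the base rule demands, hold
  for scaled pairs: reflexive reduction commutes with scaling, so a unit modulo \<open>kn\<close> relating
  \<open>kR\<close> and \<open>kS\<close> would be a unit modulo \<open>n\<close> relating \<open>R\<close> and \<open>S\<close>.\<close>

lemma type2_jumps_not_mult:
  assumes "type2_jumps n m R S" "coprime y n"
  shows "S \<noteq> mult_jumps n y R"
  using assms
proof (induction arbitrary: y)
  case (base R n S m r t)
  have "n > 1"
  proof (rule ccontr)
    assume "\<not> n > 1"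
    then have "n div 2 = 0" by simp
    then have "R = {}" using base.hyps(1) by simp
    then show False using base.hyps(3) by simp
  qed
  then have "y mod n \<in> totatives n"
    using base.prems by (auto simp: totatives_def intro!: gr0I)
  moreover have "mult_jumps n (y mod n) R = mult_jumps n y R"
    by (simp add: mult_jumps_def reflexive_reduction_def mod_simps)
  ultimately show ?case using base.hyps by metis
next
  case (scale n m R S k)
  have "mult_jumps (k * n) y ((*) k ` R) = (*) k ` mult_jumps n y R"
    using reflexive_reduction_scale[OF scale.hyps(2)]
    by (simp add: mult_jumps_def image_image mult.left_commute[of y])
  moreover have "inj ((*) k)" using scale.hyps(2) by (auto intro: injI)
  moreover have "S \<noteq> mult_jumps n y R" using scale.IH scale.prems by simp
  ultimately show ?case by (simp add: inj_image_eq_iff)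
qed

lemma type2_isomorphic_circulant_iff:
  assumes "R \<subseteq> {1..n div 2}" "S \<subseteq> {1..n div 2}"
  shows "type2_isomorphic m (circulant n R) (circulant n S) \<longleftrightarrow> type2_jumps n m R S"
proof
  assume "type2_isomorphic m (circulant n R) (circulant n S)"
  then obtain n' R' S' where *: "circulant n R = circulant n' R'" "circulant n S = circulant n' S'"
    "type2_jumps n' m R' S'" by (auto simp: type2_isomorphic_def)
  have "{0..<n} = {0..<n'}" using *(1) by (simp add: circulant_def)
  then have "n' = n" by (metis card_atLeastLessThan diff_zero)
  moreover from this have "R' = R" "S' = S"
    using circulant_inject assms * type2_jumps_subset[OF *(3)] by blast+
  ultimately show "type2_jumps n m R S" using * by simp
qed (auto simp: type2_isomorphic_def)


section \<open>Cosets of 18 in the integers modulo 54\<close>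

text \<open>The jump set in \<open>{0..27}\<close> whose differences modulo 54 are \<open>\<plusminus>a + 18\<int>\<close>. This form makes
  \<open>{1, 17, 19}\<close>, \<open>{7, 11, 25}\<close> and the other four sets instances of one family.\<close>

definition coset_jumps :: "nat \<Rightarrow> nat set" where
  "coset_jumps a = reflexive_reduction 54 ` {a, a + 18, a + 36}"

lemma differences_coset_jumps:
  "differences 54 (coset_jumps a) = {d. [d = int a] (mod 18) \<or> [d = - int a] (mod 18)}"
proof -
  have z: "18 dvd z \<longleftrightarrow> 54 dvd z \<or> 54 dvd z - 18 \<or> 54 dvd z - 36"
    "18 dvd z \<longleftrightarrow> 54 dvd z \<or> 54 dvd z + 18 \<or> 54 dvd z + 36" for z :: int
    by presburger+
  have "[d = x] (mod 18) \<longleftrightarrow>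
    [d = x] (mod 54) \<or> [d = x + 18] (mod 54) \<or> [d = x + 36] (mod 54)" for d x :: int
    using z(1)[of "d - x"] unfolding cong_iff_dvd_diff by (simp only: diff_diff_eq)
  moreover have "[d = - x] (mod 18) \<longleftrightarrow>
    [d = - x] (mod 54) \<or> [d = - (x + 18)] (mod 54) \<or> [d = - (x + 36)] (mod 54)" for d x :: int
    using z(2)[of "d + x"] unfolding cong_iff_dvd_diff
    by (simp only: diff_minus_eq_add add.assoc)
  ultimately have "(\<exists>r\<in>{a, a + 18, a + 36}. [d = int r] (mod 54) \<or> [d = - int r] (mod 54)) \<longleftrightarrow>
    [d = int a] (mod 18) \<or> [d = - int a] (mod 18)" for d
    by (simp only: bex_simps of_nat_add of_nat_numeral) blast
  then show ?thesis
    unfolding coset_jumps_def differences_reflexive_reduction[OF zero_less_numeral]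
    by (simp only: differences_def of_nat_numeral)
qed

lemma coset_jumps_subset:
  assumes "\<not> 3 dvd a"
  shows "coset_jumps a \<subseteq> {1..54 div 2}"
proof -
  have "\<not> 54 dvd b" if "b \<in> {a, a + 18, a + 36}" for b
    using assms that by auto presburger+
  then show ?thesis
    using reflexive_reduction_le[of 54] reflexive_reduction_pos[of 54]
    by (force simp: coset_jumps_def)
qed

lemma coset_jumps_cong:
  assumes "\<not> 3 dvd a" "[a = b] (mod 18)"
  shows "coset_jumps a = coset_jumps b"
proof -
  have ab: "[int a = int b] (mod 18)"
    using assms(2) by (metis cong_int_iff of_nat_numeral)
  have "[a = b] (mod 3)" using assms(2) by (rule cong_dvd_mono_modulus) simp
  then have b: "\<not> 3 dvd b" using assms(1) cong_dvd_iff by blast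
  have "[- int a = - int b] (mod 18)" using ab by (simp only: cong_minus_minus_iff)
  with ab have "[d = int a] (mod 18) \<longleftrightarrow> [d = int b] (mod 18)"
    "[d = - int a] (mod 18) \<longleftrightarrow> [d = - int b] (mod 18)" for d
    by (simp_all only: cong_def)
  then have "differences 54 (coset_jumps a) = differences 54 (coset_jumps b)"
    by (simp only: differences_coset_jumps)
  with coset_jumps_subset[OF assms(1)] coset_jumps_subset[OF b] show ?thesis
    by (rule differences_inject)
qed

text \<open>If two of the three representatives had the same reduction, they would agree up to sign
  modulo 54. Their differences are 0, 18 and 36 up to sign, and a sum of two of them is congruent to \<open>2a\<close> modulo 3,
  hence not divisible by 3.\<close>

lemma card_coset_jumps:
  assumes "\<not> 3 dvd a"
  shows "card (coset_jumps a) = 3"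
proof -
  have "x = y" if "x \<in> {a, a + 18, a + 36}" "y \<in> {a, a + 18, a + 36}"
    "reflexive_reduction 54 x = reflexive_reduction 54 y" for x y
  proof -
    have "differences 54 {x} = differences 54 {y}"
      using that(3) differences_reflexive_reduction[of 54 "{x}"]
        differences_reflexive_reduction[of 54 "{y}"] by simp
    moreover have "int x \<in> differences 54 {x}" by (simp add: differences_def)
    ultimately have "54 dvd int x - int y \<or> 54 dvd int x + int y"
      by (simp add: differences_def cong_iff_dvd_diff)
    moreover have "\<not> 3 dvd int x + int y"
      using that(1,2) assms by auto presburger+
    then have "\<not> 54 dvd int x + int y" using dvd_trans[of 3 54 "int x + int y"] by auto
    ultimately show ?thesis
      using that(1,2) by auto
  qed
  then have "inj_on (reflexive_reduction 54) {a, a + 18, a + 36}"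
    by (rule inj_onI)
  then show ?thesis
    by (simp add: coset_jumps_def card_image)
qed

lemma M54_dvd: "r \<in> M54 \<Longrightarrow> 3 dvd r"
  by (auto simp: M54_def)

lemma M54_subset: "M54 \<subseteq> {1..54 div 2}"
  by (auto simp: M54_def)

lemma differences_M54_dvd:
  assumes "T \<subseteq> M54" "d \<in> differences 54 T"
  shows "3 dvd d"
proof -
  obtain r where r: "r \<in> T" "54 dvd d - int r \<or> 54 dvd d + int r"
    using assms(2) by (auto simp: differences_def cong_iff_dvd_diff)
  then have "3 dvd int r" using assms(1) M54_dvd by (metis int_dvd_int_iff of_nat_numeral subsetD)
  moreover have "3 dvd d - int r \<or> 3 dvd d + int r"
    using r(2) by (auto intro: dvd_trans[of 3 54])
  ultimately show ?thesis by presburger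
qed

lemma differences_dvd:
  assumes "\<not> 3 dvd a" "3 dvd d"
  shows "d \<in> differences 54 (coset_jumps a \<union> T) \<longleftrightarrow> d \<in> differences 54 T"
proof -
  have "\<not> 3 dvd d - int a" "\<not> 3 dvd d + int a"
    using assms by presburger+
  then have "\<not> 18 dvd d - int a" "\<not> 18 dvd d + int a"
    by presburger+
  then show ?thesis
    by (simp add: differences_Un differences_coset_jumps cong_iff_dvd_diff)
qed

lemma differences_not_dvd:
  assumes "T \<subseteq> M54" "\<not> 3 dvd d"
  shows "d \<in> differences 54 (coset_jumps a \<union> T) \<longleftrightarrow>
    [d = int a] (mod 18) \<or> [d = - int a] (mod 18)"
  using assms differences_M54_dvd by (auto simp: differences_Un differences_coset_jumps)

lemma coprime_multiplier:
  assumes "t \<in> {2, 4}"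
  shows "coprime (int (1 + 3 * t)) 54"
proof (rule coprimeI)
  fix c assume c: "c dvd int (1 + 3 * t)" "c dvd 54"
  \<comment> \<open>Bezout coefficients: the first combination is 1 for \<open>t = 2\<close>, the second for \<open>t = 4\<close>.\<close>
  have "c dvd 31 * int (1 + 3 * t) - 4 * 54 \<and> c dvd 25 * int (1 + 3 * t) - 6 * 54"
    using c by (intro conjI dvd_diff dvd_mult)
  then show "c dvd 1" using assms by auto
qed

text \<open>The step common to \<open>theta\<close> and to multiplication by the unit \<open>1 + 3t\<close>: on differences prime
  to 3 only the class of \<open>e\<close> modulo 18 matters, so both act as multiplication by \<open>1 + 3t\<close>.\<close>

lemma differences_mult:
  assumes "t \<in> {2, 4}" "T \<subseteq> M54" "\<not> 3 dvd d" "[e = int (1 + 3 * t) * d] (mod 18)"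
  shows "d \<in> differences 54 (coset_jumps a \<union> T) \<longleftrightarrow>
    e \<in> differences 54 (coset_jumps ((1 + 3 * t) * a) \<union> T)"
proof -
  have e: "\<not> 3 dvd e"
  proof -
    have "[e = int (1 + 3 * t) * d] (mod 3)" using assms(4) by (rule cong_dvd_mono_modulus) simp
    also have "[int (1 + 3 * t) * d = d] (mod 3)"
      by (simp add: cong_iff_dvd_diff algebra_simps)
    finally show ?thesis using assms(3) cong_dvd_iff by blast
  qed
  have "coprime (int (1 + 3 * t)) 18"
    using coprime_multiplier[OF assms(1)] by (rule coprime_divisors[rotated 2]) simp_all
  then have "[int (1 + 3 * t) * d = int (1 + 3 * t) * x] (mod 18) \<longleftrightarrow> [d = x] (mod 18)" for x
    by (rule cong_mult_lcancel)
  then have "[d = x] (mod 18) \<longleftrightarrow> [e = int (1 + 3 * t) * x] (mod 18)" for x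
    using assms(4) by (simp add: cong_def)
  from this[of "int a"] this[of "- int a"] show ?thesis
    using differences_not_dvd[OF assms(2,3)] differences_not_dvd[OF assms(2) e]
    by (simp only: of_nat_mult mult_minus_right)
qed

lemma theta_coset_jumps:
  assumes t: "t \<in> {2, 4}" and T: "T \<subseteq> M54" and a: "\<not> 3 dvd a"
  defines "R \<equiv> coset_jumps a \<union> T" and "S \<equiv> coset_jumps ((1 + 3 * t) * a) \<union> T"
  shows "image_graph (theta 54 3 t) (circulant 54 R) = circulant 54 S"
    and "graph_isomorphic (circulant 54 R) (circulant 54 S)"
proof -
  have wa: "\<not> 3 dvd (1 + 3 * t) * a" using t a by auto presburger+
  have up: "d \<in> differences 54 R \<longleftrightarrow>
      d + int 3 * int t * (d mod int 3) \<in> differences 54 S" for d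
  proof (cases "3 dvd d")
    case True
    then show ?thesis
      using differences_dvd[OF a] differences_dvd[OF wa] by (simp add: R_def S_def)
  next
    case False
    have "[d + int 3 * int t * (d mod int 3) = int (1 + 3 * t) * d] (mod 18)"
      using t unfolding cong_iff_dvd_diff by auto presburger+
    then show ?thesis
      unfolding R_def S_def by (rule differences_mult[OF t T False])
  qed
  have wrap: "d \<in> differences 54 R \<longleftrightarrow>
      d + int 3 * int t * (d mod int 3 - int 3) \<in> differences 54 S" if "\<not> int 3 dvd d" for d
  proof -
    \<comment> \<open>The wrap-around changes the value by \<open>9t\<close>, a multiple of 18 as \<open>t\<close> is even.\<close>
    have "[d + int 3 * int t * (d mod int 3 - int 3) = int (1 + 3 * t) * d] (mod 18)"
      using t unfolding cong_iff_dvd_diff by auto presburger+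
    with that show ?thesis
      unfolding R_def S_def by (intro differences_mult[OF t T]) auto
  qed
  show "image_graph (theta 54 3 t) (circulant 54 R) = circulant 54 S"
    and "graph_isomorphic (circulant 54 R) (circulant 54 S)"
    using theta_circulant[of 3 54 R t S] up wrap by simp_all
qed

text \<open>On multiples of 3 only the multiplier modulo 18 matters. There \<open>7\<^sup>2\<close> agrees with 13 and
  \<open>13\<^sup>2\<close> with 7, so stability under 7 and under 13 are equivalent.\<close>

lemma mult_7_stable_iff:
  assumes "t \<in> {2, 4}" "T \<subseteq> M54"
  shows "mult_jumps 54 7 T = T \<longleftrightarrow>
    (\<forall>d. d \<in> differences 54 T \<longleftrightarrow> int (1 + 3 * t) * d \<in> differences 54 T)"
proof -
  have T: "T \<subseteq> {1..54 div 2}" using assms(2) M54_subset by blast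
  have "coprime 7 (54::nat)"
    using coprime_multiplier[of 2] coprime_int_iff[of 7 54] by simp
  then have 7: "mult_jumps 54 7 T = T \<longleftrightarrow>
      (\<forall>d. d \<in> differences 54 T \<longleftrightarrow> 7 * d \<in> differences 54 T)"
    using mult_jumps_eq_iff[of 54 7 T T] T by auto
  have dvd: "3 dvd d" if "d \<in> differences 54 T \<or> 7 * d \<in> differences 54 T \<or>
      13 * d \<in> differences 54 T" for d
  proof -
    have "3 dvd d \<or> 3 dvd 7 * d \<or> 3 dvd 13 * d"
      using that differences_M54_dvd[OF assms(2)] by blast
    then show ?thesis by presburger
  qed
  have A: "7 * (7 * d) \<in> differences 54 T \<longleftrightarrow> 13 * d \<in> differences 54 T" if "3 dvd d" for d
    using that by (intro differences_cong) (auto simp: cong_iff_dvd_diff)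
  have B: "13 * (13 * d) \<in> differences 54 T \<longleftrightarrow> 7 * d \<in> differences 54 T" for d
    by (intro differences_cong) (auto simp: cong_iff_dvd_diff)
  have "(\<forall>d. d \<in> differences 54 T \<longleftrightarrow> 7 * d \<in> differences 54 T) \<longleftrightarrow>
      (\<forall>d. d \<in> differences 54 T \<longleftrightarrow> 13 * d \<in> differences 54 T)"
  proof (rule iffI; rule allI)
    fix d assume 7: "\<forall>d. d \<in> differences 54 T \<longleftrightarrow> 7 * d \<in> differences 54 T"
    show "d \<in> differences 54 T \<longleftrightarrow> 13 * d \<in> differences 54 T"
    proof (cases "3 dvd d")
      case True
      have "d \<in> differences 54 T \<longleftrightarrow> 7 * (7 * d) \<in> differences 54 T"
        using spec[OF 7, of d] spec[OF 7, of "7 * d"] by simp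
      with A[OF True] show ?thesis by simp
    next
      case False
      with dvd[of d] show ?thesis by blast
    qed
  next
    fix d assume 13: "\<forall>d. d \<in> differences 54 T \<longleftrightarrow> 13 * d \<in> differences 54 T"
    show "d \<in> differences 54 T \<longleftrightarrow> 7 * d \<in> differences 54 T"
      using spec[OF 13, of d] spec[OF 13, of "13 * d"] B[of d] by simp
  qed
  moreover have "int (1 + 3 * t) = 7 \<or> int (1 + 3 * t) = 13" using assms(1) by auto
  ultimately show ?thesis using 7 by metis
qed

text \<open>If \<open>7T = T\<close>, then multiplication by the unit \<open>1 + 3t\<close> does the same as \<open>theta\<close>, which rules out
  Type 2. Conversely, a unit \<open>y\<close> relating the two jump sets sends the difference \<open>a\<close> to
  \<open>\<plusminus>(1 + 3t)a\<close> modulo 18; as \<open>a\<close> is prime to 3 and \<open>y\<close> is odd, this pins down \<open>y\<close> modulo 18 up to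
  sign, hence its action on the multiples of 3, and forces \<open>7T = T\<close>.\<close>

lemma type2_coset_jumps_iff:
  assumes t: "t \<in> {2, 4}" and T: "T \<subseteq> M54" "T \<noteq> {}" and a: "\<not> 3 dvd a"
  shows "type2_isomorphic 3 (circulant 54 (coset_jumps a \<union> T))
      (circulant 54 (coset_jumps ((1 + 3 * t) * a) \<union> T)) \<longleftrightarrow>
    mult_jumps 54 7 T \<noteq> T"
proof -
  define w where "w = 1 + 3 * t"
  define R S where "R = coset_jumps a \<union> T" and "S = coset_jumps (w * a) \<union> T"
  have wa: "\<not> 3 dvd w * a" using t a unfolding w_def by auto presburger+
  have RS: "R \<subseteq> {1..54 div 2}" "S \<subseteq> {1..54 div 2}"
    using coset_jumps_subset[OF a] coset_jumps_subset[OF wa] T(1) M54_subset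
    unfolding R_def S_def by blast+
  have stable: "mult_jumps 54 7 T = T \<longleftrightarrow>
      (\<forall>d. d \<in> differences 54 T \<longleftrightarrow> int w * d \<in> differences 54 T)"
    unfolding w_def by (rule mult_7_stable_iff[OF t T(1)])
  have "type2_jumps 54 3 R S \<longleftrightarrow> mult_jumps 54 7 T \<noteq> T"
  proof
    assume type2: "type2_jumps 54 3 R S"
    show "mult_jumps 54 7 T \<noteq> T"
    proof
      assume st: "mult_jumps 54 7 T = T"
      have "d \<in> differences 54 R \<longleftrightarrow> int w * d \<in> differences 54 S" for d
      proof (cases "3 dvd d")
        case True
        then show ?thesis
          using differences_dvd[OF a] differences_dvd[OF wa] st stable
          by (simp add: R_def S_def)
      next
        case False
        then show ?thesis
          using differences_mult[OF t T(1) False] by (simp add: R_def S_def w_def)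
      qed
      moreover have "coprime w 54"
        using coprime_multiplier[OF t] unfolding w_def
        by (metis coprime_int_iff of_nat_numeral)
      ultimately show False
        using mult_jumps_eq_iff[of 54 w R S] RS type2_jumps_not_mult[OF type2, of w] by simp
    qed
  next
    assume ns: "mult_jumps 54 7 T \<noteq> T"
    obtain r where r: "r \<in> T" using T(2) by blast
    have "S \<noteq> mult_jumps 54 y R" if y: "y \<in> totatives 54" for y
    proof
      assume eq: "S = mult_jumps 54 y R"
      have cop: "coprime y 54" using y by (simp add: totatives_def)
      then have "coprime y (2 * 3 * 9)" by simp
      then have y2: "odd y" and y3: "coprime y 3"
        unfolding coprime_mult_right_iff coprime_right_2_iff_odd by blast+
      have y3': "coprime (int y) 3" using y3 by (metis coprime_int_iff of_nat_numeral)
      have mult: "d \<in> differences 54 R \<longleftrightarrow> int y * d \<in> differences 54 S" for d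
        using eq mult_jumps_eq_iff[of 54 y R S] cop RS by simp
      have a': "\<not> 3 dvd int a" using a by presburger
      have "int a \<in> differences 54 R"
        by (simp add: R_def differences_Un differences_coset_jumps)
      then have "int y * int a \<in> differences 54 S" using mult by blast
      moreover have "\<not> 3 dvd int y * int a"
        using y3' a' by (simp add: coprime_commute coprime_dvd_mult_right_iff)
      ultimately have "[int y * int a = int w * int a] (mod 18) \<or>
          [int y * int a = - (int w * int a)] (mod 18)"
        using differences_not_dvd[OF T(1)] by (simp add: S_def)
      then have "18 dvd (int y - int w) * int a \<or> 18 dvd (int y - - int w) * int a"
        by (simp add: cong_iff_dvd_diff algebra_simps)
      \<comment> \<open>\<open>c\<close> is \<open>1 + 3t\<close> with the sign for which \<open>y\<close> agrees with it modulo 18.\<close>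
      then obtain c where c: "c = int w \<or> c = - int w" "18 dvd (int y - c) * int a"
        by blast
      have "coprime (3 ^ 2) (int a)"
        using a' prime_imp_coprime[of 3 "int a"] coprime_power_left_iff[of 3 2 "int a"] by simp
      moreover have "3 ^ 2 dvd (int y - c) * int a" using c(2) by (auto elim: dvd_trans[rotated])
      ultimately have "9 dvd int y - c" by (simp add: coprime_dvd_mult_left_iff)
      \<comment> \<open>\<open>a\<close> may be even, so the factor 2 of 18 has to come from the parities of \<open>y\<close> and \<open>c\<close>.\<close>
      moreover have "even (int y - c)" using y2 c(1) t by (auto simp: w_def)
      ultimately have 18: "18 dvd int y - c" by presburger
      have "d \<in> differences 54 T \<longleftrightarrow> int w * d \<in> differences 54 T" for d
      proof (cases "3 dvd d")
        case True
        then have "18 * 3 dvd (int y - c) * d" using 18 by (intro mult_dvd_mono)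
        then have "[int y * d = c * d] (mod 54)"
          by (simp add: cong_iff_dvd_diff left_diff_distrib)
        then have "int y * d \<in> differences 54 T \<longleftrightarrow> c * d \<in> differences 54 T"
          by (intro differences_cong) simp
        also have "\<dots> \<longleftrightarrow> int w * d \<in> differences 54 T"
          using c(1) differences_uminus[of "int w * d"] by auto
        finally show ?thesis
          using mult[of d] True differences_dvd[OF a] differences_dvd[OF wa]
          by (simp add: R_def S_def)
      next
        case False
        then have "\<not> 3 dvd int w * d" using t by (auto simp: w_def) presburger+
        with False show ?thesis using differences_M54_dvd[OF T(1)] by blast
      qed
      with ns stable show False by blast
    qed
    moreover have "card R \<ge> 3"
    proof -
      have "finite R" using RS(1) finite_subset by blast
      then show ?thesis
        using card_mono[of R "coset_jumps a"] card_coset_jumps[OF a] by (simp add: R_def)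
    qed
    moreover have "3 dvd gcd 54 r" using r T M54_dvd by auto
    moreover have "r \<in> R" using r by (simp add: R_def)
    moreover have "image_graph (theta 54 3 t) (circulant 54 R) = circulant 54 S"
      using theta_coset_jumps(1)[OF t T(1) a] by (simp add: R_def S_def w_def)
    ultimately show "type2_jumps 54 3 R S"
      using RS t by (intro type2_jumps.base[where r = r and t = t]) auto
  qed
  then show ?thesis
    using type2_isomorphic_circulant_iff[OF RS] by (simp add: R_def S_def w_def)
qed

section \<open>The two families of triples\<close>

definition triple :: "nat \<Rightarrow> nat set \<Rightarrow> nat graph \<times> nat graph \<times> nat graph" where
  "triple a T = (circulant 54 (coset_jumps a \<union> T), circulant 54 (coset_jumps (7 * a) \<union> T),
     circulant 54 (coset_jumps (13 * a) \<union> T))"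

text \<open>The six ordered pairs of a triple are the multiplications of \<open>a\<close>, \<open>7a\<close> and \<open>13a\<close> by 7 and by
  13, since \<open>49 = 13\<close>, \<open>91 = 1\<close> and \<open>169 = 7\<close> modulo 18.\<close>

lemma pairwise_triple_iff:
  assumes a: "\<not> 3 dvd a"
    and step: "\<And>t b. t \<in> {2, 4} \<Longrightarrow> \<not> 3 dvd b \<Longrightarrow>
      P (circulant 54 (coset_jumps b \<union> T)) (circulant 54 (coset_jumps ((1 + 3 * t) * b) \<union> T)) \<longleftrightarrow> Q"
  shows "pairwise_triple P (triple a T) \<longleftrightarrow> Q"
proof -
  have b: "\<not> 3 dvd 7 * a" "\<not> 3 dvd 13 * a" using a by presburger+
  have J: "coset_jumps (49 * a) = coset_jumps (13 * a)"
    "coset_jumps (91 * a) = coset_jumps a" "coset_jumps (169 * a) = coset_jumps (7 * a)"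
  proof -
    have *: "[13 * a = 49 * a] (mod 18)" "[7 * a = 169 * a] (mod 18)"
      by (rule cong_scalar_right, simp add: cong_def)+
    have "[1 * a = 91 * a] (mod 18)"
      by (rule cong_scalar_right) (simp add: cong_def)
    then have "[a = 91 * a] (mod 18)" by simp
    from coset_jumps_cong[OF a this] show "coset_jumps (91 * a) = coset_jumps a" by (rule sym)
    from coset_jumps_cong[OF b(2) *(1)]
    show "coset_jumps (49 * a) = coset_jumps (13 * a)" by (rule sym)
    from coset_jumps_cong[OF b(1) *(2)]
    show "coset_jumps (169 * a) = coset_jumps (7 * a)" by (rule sym)
  qed
  define G where "G k = circulant 54 (coset_jumps (k * a) \<union> T)" for k
  have "P (G 1) (G 7) \<longleftrightarrow> Q" "P (G 1) (G 13) \<longleftrightarrow> Q"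
    using step[of 2 a] step[of 4 a] a by (simp_all add: G_def)
  moreover have "P (G 7) (G 13) \<longleftrightarrow> Q" "P (G 7) (G 1) \<longleftrightarrow> Q"
    using step[OF _ b(1), of 2] step[OF _ b(1), of 4] by (simp_all add: G_def J)
  moreover have "P (G 13) (G 1) \<longleftrightarrow> Q" "P (G 13) (G 7) \<longleftrightarrow> Q"
    using step[OF _ b(2), of 2] step[OF _ b(2), of 4] by (simp_all add: G_def J)
  moreover have "triple a T = (G 1, G 7, G 13)"
    by (simp add: triple_def G_def)
  ultimately show ?thesis by (simp only: pairwise_triple.simps simp_thms)
qed

lemma tripleA_eq: "tripleA T = triple 1 T"
proof -
  have "coset_jumps 1 = {1, 17, 19}" "coset_jumps 7 = {7, 11, 25}" "coset_jumps 13 = {5, 13, 23}"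
    by (auto simp: coset_jumps_def reflexive_reduction_def)
  then show ?thesis by (simp add: tripleA_def triple_def)
qed

lemma tripleB_eq: "tripleB T = triple 2 T"
proof -
  have "coset_jumps 2 = {2, 16, 20}" "coset_jumps 14 = {4, 14, 22}" "coset_jumps 26 = {8, 10, 26}"
    by (auto simp: coset_jumps_def reflexive_reduction_def)
  then show ?thesis by (simp add: tripleB_def triple_def)
qed

lemma tripleA_inject:
  assumes "T \<subseteq> M54" "U \<subseteq> M54" "tripleA T = tripleA U"
  shows "T = U"
proof -
  have "{1, 17, 19} \<union> T = {1, 17, 19} \<union> U"
    using assms M54_subset by (intro circulant_inject[of _ 54]) (auto simp: tripleA_def)
  moreover have "{1, 17, 19} \<inter> M54 = {}" by (simp add: M54_def)
  ultimately show ?thesis using assms(1,2) by blast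
qed

lemma tripleB_inject:
  assumes "T \<subseteq> M54" "U \<subseteq> M54" "tripleB T = tripleB U"
  shows "T = U"
proof -
  have "{2, 16, 20} \<union> T = {2, 16, 20} \<union> U"
    using assms M54_subset by (intro circulant_inject[of _ 54]) (auto simp: tripleB_def)
  moreover have "{2, 16, 20} \<inter> M54 = {}" by (simp add: M54_def)
  ultimately show ?thesis using assms(1,2) by blast
qed

lemma tripleA_neq_tripleB:
  assumes "T \<subseteq> M54" "U \<subseteq> M54"
  shows "tripleA T \<noteq> tripleB U"
proof
  assume "tripleA T = tripleB U"
  then have "{1, 17, 19} \<union> T = {2, 16, 20} \<union> U"
    using assms M54_subset by (intro circulant_inject[of _ 54]) (auto simp: tripleA_def tripleB_def)
  moreover have "1 \<notin> M54" by (simp add: M54_def)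
  ultimately show False using assms(2) by auto
qed

lemma card_triples:
  assumes "\<TT> \<subseteq> Pow M54"
  shows "card (tripleA ` \<TT> \<union> tripleB ` \<TT>) = 2 * card \<TT>"
proof -
  have "finite \<TT>" using assms by (rule finite_subset) (simp add: M54_def)
  moreover have "tripleA T \<noteq> tripleB U" if "T \<in> \<TT>" "U \<in> \<TT>" for T U
    using that assms by (intro tripleA_neq_tripleB) auto
  then have "tripleA ` \<TT> \<inter> tripleB ` \<TT> = {}" by blast
  moreover have "inj_on tripleA \<TT>"
    by (rule inj_onI, rule tripleA_inject) (use assms in auto)
  moreover have "inj_on tripleB \<TT>"
    by (rule inj_onI, rule tripleB_inject) (use assms in auto)
  ultimately show ?thesis
    by (simp add: card_Un_disjoint card_image)
qed

definition orbits7 :: "nat set set" where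
  "orbits7 = {{3, 15, 21}, {6, 12, 24}, {9}, {18}, {27}}"

lemma mult_7_orbit: "Y \<in> orbits7 \<Longrightarrow> mult_jumps 54 7 Y = Y"
  by (auto simp: orbits7_def mult_jumps_def reflexive_reduction_def)

lemma mult_7_stable_eq: "{T \<in> Pow M54. mult_jumps 54 7 T = T} = Union ` Pow orbits7"
proof (intro equalityI subsetI)
  fix T assume "T \<in> Union ` Pow orbits7"
  then obtain \<Y> where Y: "\<Y> \<subseteq> orbits7" "T = \<Union>\<Y>" by blast
  have "mult_jumps 54 7 T = \<Union> (mult_jumps 54 7 ` \<Y>)"
    by (auto simp: Y(2) mult_jumps_def)
  also have "\<dots> = T" using Y mult_7_orbit by auto
  finally have "mult_jumps 54 7 T = T" .
  moreover have "\<Union> orbits7 = M54" by (auto simp: orbits7_def M54_def)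
  ultimately show "T \<in> {T \<in> Pow M54. mult_jumps 54 7 T = T}" using Y by blast
next
  fix T assume T: "T \<in> {T \<in> Pow M54. mult_jumps 54 7 T = T}"
  have *: "reflexive_reduction 54 (7 * r) \<in> T" if "r \<in> T" for r
    using T that unfolding mult_jumps_def by blast
  have "3 \<in> T \<Longrightarrow> 21 \<in> T" "21 \<in> T \<Longrightarrow> 15 \<in> T" "15 \<in> T \<Longrightarrow> 3 \<in> T"
    "6 \<in> T \<Longrightarrow> 12 \<in> T" "12 \<in> T \<Longrightarrow> 24 \<in> T" "24 \<in> T \<Longrightarrow> 6 \<in> T"
    using *[of 3] *[of 21] *[of 15] *[of 6] *[of 12] *[of 24]
    by (simp_all add: reflexive_reduction_def)
  then have same: "21 \<in> T \<longleftrightarrow> 3 \<in> T" "15 \<in> T \<longleftrightarrow> 3 \<in> T" "12 \<in> T \<longleftrightarrow> 6 \<in> T" "24 \<in> T \<longleftrightarrow> 6 \<in> T"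
    by argo+
  have "\<exists>Y\<in>orbits7. x \<in> Y \<and> Y \<subseteq> T" if "x \<in> T" for x
  proof -
    have "x \<in> M54" using that T by blast
    then consider "x \<in> {3, 15, 21}" | "x \<in> {6, 12, 24}" | "x \<in> {9, 18, 27}"
      unfolding M54_def by blast
    then show ?thesis
    proof cases
      case 1
      then have "{3, 15, 21} \<subseteq> T" using that same by auto
      moreover have "{3, 15, 21} \<in> orbits7" by (simp add: orbits7_def)
      ultimately show ?thesis using 1 by (intro bexI conjI)
    next
      case 2
      then have "{6, 12, 24} \<subseteq> T" using that same by auto
      moreover have "{6, 12, 24} \<in> orbits7" by (simp add: orbits7_def)
      ultimately show ?thesis using 2 by (intro bexI conjI)
    next
      case 3
      then have "{x} \<in> orbits7" by (auto simp: orbits7_def)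
      moreover have "x \<in> {x}" "{x} \<subseteq> T" using that by simp_all
      ultimately show ?thesis by (intro bexI conjI)
    qed
  qed
  then have "T = \<Union>{Y \<in> orbits7. Y \<subseteq> T}" by blast
  then show "T \<in> Union ` Pow orbits7" by blast
qed

lemma card_mult_7_stable: "card {T \<in> Pow M54. mult_jumps 54 7 T = T} = 32"
proof -
  have disj: "Y = Z" if "Y \<in> orbits7" "Z \<in> orbits7" "x \<in> Y" "x \<in> Z" for x Y Z
    using that by (auto simp: orbits7_def)
  have "inj_on Union (Pow orbits7)"
  proof (rule inj_onI)
    fix \<Y> \<Z> assume YZ: "\<Y> \<in> Pow orbits7" "\<Z> \<in> Pow orbits7" "\<Union>\<Y> = \<Union>\<Z>"
    have sub: "\<A> \<subseteq> \<B>" if AB: "\<A> \<subseteq> orbits7" "\<B> \<subseteq> orbits7" "\<Union>\<A> = \<Union>\<B>" for \<A> \<B>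
    proof
      fix Y assume Y: "Y \<in> \<A>"
      then obtain x where x: "x \<in> Y" using AB(1) by (auto simp: orbits7_def)
      then obtain Z where Z: "Z \<in> \<B>" "x \<in> Z" using Y AB(3) by blast
      then have "Y = Z" using Y x AB(1,2) by (intro disj[of Y Z x]) auto
      then show "Y \<in> \<B>" using Z by simp
    qed
    show "\<Y> = \<Z>" by (rule equalityI; rule sub) (use YZ in simp_all)
  qed
  then have "card (Union ` Pow orbits7) = card (Pow orbits7)" by (rule card_image)
  also have "\<dots> = 2 ^ card orbits7" by (rule card_Pow) (simp add: orbits7_def)
  also have "card orbits7 = 5"
  proof -
    \<comment> \<open>The orbits are told apart by their least elements.\<close>
    have "distinct (map Min [{3, 15, 21}, {6, 12, 24}, {9}, {18}, {27 :: nat}])"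
      by simp
    then have "distinct [{3, 15, 21}, {6, 12, 24}, {9}, {18}, {27 :: nat}]"
      by (simp only: distinct_map)
    from distinct_card[OF this] show ?thesis by (simp add: orbits7_def)
  qed
  also have "(2 :: nat) ^ 5 = 32" by simp
  finally show ?thesis unfolding mult_7_stable_eq .
qed

theorem mainTheorem1:
  "(\<forall>T. T \<subseteq> M54 \<and> T \<noteq> {} \<longrightarrow>
        pairwise_triple graph_isomorphic (tripleA T) \<and>
        pairwise_triple graph_isomorphic (tripleB T)) \<and>
   card triples54 = 1022 \<and>
   card {X \<in> triples54. pairwise_triple (type2_isomorphic 3) X} = 960"
proof (intro conjI allI impI)
  have prime_to_3: "\<not> 3 dvd (1 :: nat)" "\<not> 3 dvd (2 :: nat)" by simp_all
  fix T assume T: "T \<subseteq> M54 \<and> T \<noteq> {}"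
  have "pairwise_triple graph_isomorphic (triple a T)" if "\<not> 3 dvd a" for a
    using pairwise_triple_iff[OF that, where P = graph_isomorphic and Q = True]
      theta_coset_jumps(2) T by blast
  then show "pairwise_triple graph_isomorphic (tripleA T)"
    "pairwise_triple graph_isomorphic (tripleB T)"
    using prime_to_3 by (simp_all add: tripleA_eq tripleB_eq)
next
  have M: "finite M54" "card M54 = 9" by (simp_all add: M54_def)
  have Pow: "card (Pow M54 - {{}}) = 511"
    using M by (simp add: card_Pow card_Diff_singleton)
  have triples: "triples54 = tripleA ` (Pow M54 - {{}}) \<union> tripleB ` (Pow M54 - {{}})"
    by (auto simp: triples54_def)
  have "card triples54 = 2 * card (Pow M54 - {{}})"
    unfolding triples by (rule card_triples) blast
  then show "card triples54 = 1022" unfolding Pow by simp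
  define \<S> where "\<S> = {T \<in> Pow M54. mult_jumps 54 7 T = T}"
  have type2: "pairwise_triple (type2_isomorphic 3) (triple a T) \<longleftrightarrow> T \<notin> \<S>"
    if "\<not> 3 dvd a" "T \<in> Pow M54 - {{}}" for a T
    using pairwise_triple_iff[OF that(1), where P = "type2_isomorphic 3" and Q = "T \<notin> \<S>" and T = T]
      type2_coset_jumps_iff[of _ T] that(2) by (auto simp: \<S>_def)
  have "{} \<in> \<S>" by (simp add: \<S>_def mult_jumps_def)
  then have sel: "{T \<in> Pow M54 - {{}}. pairwise_triple (type2_isomorphic 3) (triple a T)} = Pow M54 - \<S>"
    if "\<not> 3 dvd a" for a
    using type2[OF that] by blast
  have "{X \<in> triples54. pairwise_triple (type2_isomorphic 3) X} =
      tripleA ` {T \<in> Pow M54 - {{}}. pairwise_triple (type2_isomorphic 3) (tripleA T)} \<union>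
      tripleB ` {T \<in> Pow M54 - {{}}. pairwise_triple (type2_isomorphic 3) (tripleB T)}"
    unfolding triples by blast
  also have "\<dots> = tripleA ` (Pow M54 - \<S>) \<union> tripleB ` (Pow M54 - \<S>)"
    unfolding tripleA_eq tripleB_eq using sel[of 1] sel[of 2] by simp
  finally have "{X \<in> triples54. pairwise_triple (type2_isomorphic 3) X} =
      tripleA ` (Pow M54 - \<S>) \<union> tripleB ` (Pow M54 - \<S>)" .
  moreover have "card (Pow M54 - \<S>) = 480"
  proof -
    have "card (Pow M54 - \<S>) = card (Pow M54) - card \<S>"
      by (rule card_Diff_subset) (use M in \<open>auto simp: \<S>_def\<close>)
    then show ?thesis
      using M card_mult_7_stable by (simp add: card_Pow \<S>_def)
  qed
  moreover have "card (tripleA ` (Pow M54 - \<S>) \<union> tripleB ` (Pow M54 - \<S>)) =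
      2 * card (Pow M54 - \<S>)"
    by (rule card_triples) blast
  ultimately show "card {X \<in> triples54. pairwise_triple (type2_isomorphic 3) X} = 960"
    by simp
qed

end
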